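(* Let $K>0$, $\gamma\geq2$, $\bar\rho>0$, $R>0$, and let $(\rho,u)$ be a $C^1$ solution on $\mathbb{R}$ of the one-dimensional Euler equations $$\rho_t+(\rho u)_x=0,\qquad \rho(u_t+uu_x)+P_x=0,\qquad P=K\rho^\gamma,$$ with initial data $(\rho(0,x),u(0,x))=(\bar\rho+\rho_0(x),u_0(x))$, $\operatorname{supp}(\rho_0,u_0)\subseteq\{x:|x|\leq R\}$, and with $\rho>0$ (non-vacuum). Let $\sigma=\sqrt{K\gamma\bar\rho^{\gamma-1}}$ and define $$H_4(t)=\int_{-\infty}^{+\infty}xu(t,x)\,dx,\qquad m_2(t)=\int_{-\infty}^{+\infty}(\rho(t,x)-\bar\rho)\,dx.$$ If $H_4(0)>\frac{8\sigma R^2}{3}$ and $m_2(0)\geq0$, then the $C^1$ solution blows up in finite time, i.e. its life span is finite. *)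

theory Defs
  imports "HOL-Analysis.Analysis"
begin

definition C1_partials ::
  "(real \<times> real) set \<Rightarrow> (real \<Rightarrow> real \<Rightarrow> real) \<Rightarrow> (real \<Rightarrow> real \<Rightarrow> real)
     \<Rightarrow> (real \<Rightarrow> real \<Rightarrow> real) \<Rightarrow> bool" where
  "C1_partials S f ft fx \<longleftrightarrow>
     continuous_on S (\<lambda>(t, x). ft t x) \<and> continuous_on S (\<lambda>(t, x). fx t x) \<and>
     (\<forall>t x. (t, x) \<in> S \<longrightarrow>
        ((\<lambda>(s, y). f s y) has_derivative (\<lambda>(ds, dy). ft t x * ds + fx t x * dy))
          (at (t, x) within S))"

text \<open>A C^1 non-vacuum solution of the 1D isentropic Euler equations on [0,T) x R with
  pressure P = K rho^gamma and initial data (rho(0,.), u(0,.)) = (rhoI, uI).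
  P_x is written out by the chain rule: P_x = K gamma rho^(gamma-1) rho_x.\<close>
definition euler_C1_solution ::
  "real \<Rightarrow> real \<Rightarrow> real \<Rightarrow> (real \<Rightarrow> real) \<Rightarrow> (real \<Rightarrow> real)
     \<Rightarrow> (real \<Rightarrow> real \<Rightarrow> real) \<Rightarrow> (real \<Rightarrow> real \<Rightarrow> real) \<Rightarrow> bool" where
  "euler_C1_solution K \<gamma> T rhoI uI \<rho> u \<longleftrightarrow>
     (\<exists>\<rho>t \<rho>x ut ux.
        C1_partials ({0..<T} \<times> UNIV) \<rho> \<rho>t \<rho>x \<and>
        C1_partials ({0..<T} \<times> UNIV) u ut ux \<and>
        (\<forall>t x. 0 \<le> t \<and> t < T \<longrightarrow>
            \<rho> t x > 0 \<and>
            \<rho>t t x + (\<rho>x t x * u t x + \<rho> t x * ux t x) = 0 \<and>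
            \<rho> t x * (ut t x + u t x * ux t x) + K * \<gamma> * \<rho> t x powr (\<gamma> - 1) * \<rho>x t x = 0) \<and>
        (0 < T \<longrightarrow> (\<forall>x. \<rho> 0 x = rhoI x \<and> u 0 x = uI x)))"

end

theory Submission
  imports Defs
begin

text \<open>
  The Riemann invariants \<open>u \<plusminus> 2 c / (\<gamma> - 1)\<close> satisfy transport equations with speeds \<open>u \<plusminus> c\<close>, so a
  maximum principle on trapezoids shows that disturbances of the constant state travel at most at
  speed \<open>\<sigma>\<close>: the state is \<open>(\<rho>b, 0)\<close> for \<open>\<bar>x\<bar> > R + \<sigma> t\<close>. The velocity equation is
  \<open>u\<^sub>t = - B\<^sub>x\<close> with \<open>B = u\<^sup>2/2 + h(\<rho>) - h(\<rho>b)\<close>, so \<open>H\<^sub>4' = \<integral> B dx\<close>. The enthalpy \<open>h\<close> is convex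
  for \<open>\<gamma> \<ge> 2\<close> and the excess mass is conserved and nonnegative, whence, by Cauchy-Schwarz on the
  support, \<open>H\<^sub>4' \<ge> \<integral> u\<^sup>2/2 dx \<ge> (3/4) H\<^sub>4\<^sup>2 / (R + \<sigma> t)\<^sup>3\<close>. Integrating this Riccati inequality gives
  \<open>1 / H\<^sub>4(0) > 3/(8 \<sigma>) (1/R\<^sup>2 - 1/(R + \<sigma> t)\<^sup>2)\<close>, which fails for large \<open>t\<close> if \<open>H\<^sub>4(0) > 8 \<sigma> R\<^sup>2 / 3\<close>.
\<close>

section \<open>Trapezoids, the chain rule along curves and a transport maximum principle\<close>

text \<open>The base is \<open>[a, b]\<close> and both sides move inwards with speed
  \<open>s\<close>, so a step back in time with speed at most \<open>s\<close> stays in the set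
  until time 0.\<close>

definition trapezoid :: "real \<Rightarrow> real \<Rightarrow> real \<Rightarrow> real \<Rightarrow> (real \<times> real) set" where
  "trapezoid a b s \<tau> = {(t, x). 0 \<le> t \<and> t \<le> \<tau> \<and> a + s * t \<le> x \<and> x \<le> b - s * t}"

lemma compact_trapezoid:
  assumes "0 \<le> s"
  shows "compact (trapezoid a b s \<tau>)"
proof -
  have sub: "trapezoid a b s \<tau> \<subseteq> {0..\<tau>} \<times> {a..b}"
  proof
    fix p assume "p \<in> trapezoid a b s \<tau>"
    moreover from this have "0 \<le> s * fst p"
      using assms by (auto simp: trapezoid_def)
    ultimately show "p \<in> {0..\<tau>} \<times> {a..b}"
      by (auto simp: trapezoid_def)
  qed
  have "trapezoid a b s \<tau> =
      {p. 0 \<le> fst p} \<inter> {p. fst p \<le> \<tau>} \<inter> {p. a + s * fst p \<le> snd p} \<inter> {p. snd p \<le> b - s * fst p}"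
    by (auto simp: trapezoid_def)
  moreover have "closed \<dots>"
    by (intro closed_Int closed_Collect_le continuous_intros)
  ultimately have "closed (trapezoid a b s \<tau>)" by simp
  then have "compact (({0..\<tau>} \<times> {a..b}) \<inter> trapezoid a b s \<tau>)"
    by (intro compact_Int_closed compact_Times compact_Icc)
  then show ?thesis
    using sub by (simp add: inf.absorb2)
qed

lemma C1_partials_continuous_on:
  assumes "C1_partials S f ft fx"
  shows "continuous_on S (\<lambda>(t, x). f t x)"
  unfolding continuous_on_eq_continuous_within
  using assms unfolding C1_partials_def
  by (auto intro: has_derivative_continuous)

text \<open>Stated with derivatives within sets so that it covers time 0, where only one-sided time
  derivatives exist.\<close>

lemma C1_partials_along_curve:
  assumes f: "C1_partials S f ft fx"
    and g: "(g has_real_derivative g') (at r within A)"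
    and h: "(h has_real_derivative h') (at r within A)"
    and sub: "\<And>r. r \<in> A \<Longrightarrow> (g r, h r) \<in> S" and r: "r \<in> A"
  shows "((\<lambda>r. f (g r) (h r)) has_real_derivative (ft (g r) (h r) * g' + fx (g r) (h r) * h'))
           (at r within A)"
proof -
  have "((\<lambda>r. (g r, h r)) has_derivative (\<lambda>d. (g' * d, h' * d))) (at r within A)"
    using g h unfolding has_field_derivative_def by (rule has_derivative_Pair)
  moreover have "((\<lambda>(s, y). f s y) has_derivative
      (\<lambda>(ds, dy). ft (g r) (h r) * ds + fx (g r) (h r) * dy))
      (at (g r, h r) within (\<lambda>r. (g r, h r)) ` A)"
    by (rule has_derivative_subset[of _ _ _ S])
       (use f sub r in \<open>auto simp: C1_partials_def\<close>)
  ultimately have "((\<lambda>r. (\<lambda>(s, y). f s y) (g r, h r)) has_derivative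
      (\<lambda>d. (\<lambda>(ds, dy). ft (g r) (h r) * ds + fx (g r) (h r) * dy) (g' * d, h' * d)))
      (at r within A)"
    by (rule has_derivative_in_compose)
  then show ?thesis
    unfolding has_field_derivative_def prod.case
    by (rule has_derivative_eq_rhs) (auto simp: fun_eq_iff algebra_simps)
qed

text \<open>At a maximum of \<open>v - \<epsilon> t\<close> over the trapezoid with positive time, stepping back along the
  characteristic direction stays in the trapezoid and strictly increases \<open>v - \<epsilon> t\<close>.\<close>
lemma transport_max_principle:
  assumes v: "C1_partials ({0..<T} \<times> UNIV) v vt vx"
    and \<tau>: "\<tau> < T" and s: "0 \<le> s"
    and eq: "\<And>t x. (t, x) \<in> trapezoid a b s \<tau> \<Longrightarrow> vt t x + l t x * vx t x = 0"
    and speed: "\<And>t x. (t, x) \<in> trapezoid a b s \<tau> \<Longrightarrow> \<bar>l t x\<bar> \<le> s"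
    and init: "\<And>x. a \<le> x \<Longrightarrow> x \<le> b \<Longrightarrow> v 0 x \<le> 0"
    and mem: "(t, x) \<in> trapezoid a b s \<tau>"
  shows "v t x \<le> 0"
proof (rule ccontr)
  assume "\<not> v t x \<le> 0"
  then have pos: "0 < v t x" by simp
  let ?D = "trapezoid a b s \<tau>"
  have D_sub: "?D \<subseteq> {0..<T} \<times> UNIV"
    using \<tau> by (auto simp: trapezoid_def)
  have t: "0 < t"
  proof (rule ccontr)
    assume "\<not> 0 < t"
    then have "t = 0" "a \<le> x" "x \<le> b" using mem by (auto simp: trapezoid_def)
    then show False using init[of x] pos by simp
  qed
  \<comment> \<open>With this slope \<open>v - \<epsilon> t\<close> equals half of
    \<open>v t x\<close> at the given point, hence is positive there, whereas it is at most 0 on the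
    base.\<close>
  define \<epsilon> where "\<epsilon> = v t x / (2 * t)"
  have \<epsilon>: "0 < \<epsilon>" "0 < v t x - \<epsilon> * t"
    using pos t by (auto simp: \<epsilon>_def)
  have cont: "continuous_on ?D (\<lambda>p. (case p of (t, x) \<Rightarrow> v t x) - \<epsilon> * fst p)"
    by (intro continuous_intros continuous_on_subset[OF C1_partials_continuous_on[OF v] D_sub])
  obtain p where p: "p \<in> ?D"
      "\<And>q. q \<in> ?D \<Longrightarrow> (case q of (t, x) \<Rightarrow> v t x) - \<epsilon> * fst q \<le> (case p of (t, x) \<Rightarrow> v t x) - \<epsilon> * fst p"
    using continuous_attains_sup[OF compact_trapezoid[OF s] _ cont] mem by blast
  obtain t0 x0 where p_eq: "p = (t0, x0)" by fastforce
  have mem0: "(t0, x0) \<in> ?D"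
    and max: "\<And>t x. (t, x) \<in> ?D \<Longrightarrow> v t x - \<epsilon> * t \<le> v t0 x0 - \<epsilon> * t0"
    using p unfolding p_eq by force+
  have t0: "0 < t0"
  proof (rule ccontr)
    assume "\<not> 0 < t0"
    then have "t0 = 0" "a \<le> x0" "x0 \<le> b" using mem0 by (auto simp: trapezoid_def)
    then show False using init[of x0] max[OF mem] \<epsilon> by simp
  qed
  define l0 where "l0 = l t0 x0"
  have l0: "\<bar>l0\<bar> \<le> s" using speed[OF mem0] by (simp add: l0_def)
  \<comment> \<open>The step back follows a straight line with the speed frozen at
    \<open>l0\<close>; the equation at the maximum point makes the derivative of \<open>v\<close>
    along it vanish, which leaves \<open>\<epsilon>\<close>.\<close>
  define w where "w r = v (t0 - r) (x0 - l0 * r) - \<epsilon> * (t0 - r)" for r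
  have "((\<lambda>r. v (t0 - r) (x0 - l0 * r)) has_real_derivative
      (vt (t0 - 0) (x0 - l0 * 0) * (- 1) + vx (t0 - 0) (x0 - l0 * 0) * (- l0))) (at 0 within {0..t0})"
    by (rule C1_partials_along_curve[OF v])
       (use t0 mem0 \<tau> in \<open>auto intro!: derivative_eq_intros simp: trapezoid_def\<close>)
  moreover have "vt (t0 - 0) (x0 - l0 * 0) * (- 1) + vx (t0 - 0) (x0 - l0 * 0) * (- l0) = 0"
    using eq[OF mem0] by (simp add: l0_def algebra_simps)
  ultimately have "((\<lambda>r. v (t0 - r) (x0 - l0 * r)) has_real_derivative 0) (at 0 within {0..t0})"
    by metis
  then have "(w has_real_derivative \<epsilon>) (at 0 within {0..t0})"
    unfolding w_def by (auto intro!: derivative_eq_intros)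
  from has_real_derivative_pos_inc_right[OF this \<epsilon>(1)] obtain d where d: "0 < d"
      "\<And>h. 0 < h \<Longrightarrow> h \<in> {0..t0} \<Longrightarrow> h < d \<Longrightarrow> w 0 < w h"
    by auto
  define h where "h = min t0 (d / 2)"
  have h: "0 < h" "h \<le> t0" "h < d" using t0 d(1) by (auto simp: h_def)
  have "\<bar>l0 * h\<bar> \<le> s * h"
    using l0 h by (simp add: abs_mult mult_right_mono)
  then have "(t0 - h, x0 - l0 * h) \<in> ?D"
    using mem0 h by (auto simp: trapezoid_def algebra_simps)
  from max[OF this] have "w h \<le> w 0"
    by (simp add: w_def)
  with d(2)[of h] h show False by simp
qed

lemma C1_partials_minus:
  assumes "C1_partials S f ft fx"
  shows "C1_partials S (\<lambda>t x. - f t x) (\<lambda>t x. - ft t x) (\<lambda>t x. - fx t x)"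
  unfolding C1_partials_def
proof (intro conjI allI impI)
  show "continuous_on S (\<lambda>(t, x). - ft t x)" "continuous_on S (\<lambda>(t, x). - fx t x)"
    using assms by (auto simp: C1_partials_def split_beta intro: continuous_on_minus)
  fix t x assume "(t, x) \<in> S"
  then have "((\<lambda>(s, y). f s y) has_derivative (\<lambda>(ds, dy). ft t x * ds + fx t x * dy)) (at (t, x) within S)"
    using assms by (simp add: C1_partials_def)
  then show "((\<lambda>(s, y). - f s y) has_derivative (\<lambda>(ds, dy). - ft t x * ds + - fx t x * dy)) (at (t, x) within S)"
    unfolding split_beta by (auto intro!: derivative_eq_intros)
qed

lemma transport_zero:
  assumes v: "C1_partials ({0..<T} \<times> UNIV) v vt vx"
    and \<tau>: "\<tau> < T" and s: "0 \<le> s"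
    and eq: "\<And>t x. (t, x) \<in> trapezoid a b s \<tau> \<Longrightarrow> vt t x + l t x * vx t x = 0"
    and speed: "\<And>t x. (t, x) \<in> trapezoid a b s \<tau> \<Longrightarrow> \<bar>l t x\<bar> \<le> s"
    and init: "\<And>x. a \<le> x \<Longrightarrow> x \<le> b \<Longrightarrow> v 0 x = 0"
    and mem: "(t, x) \<in> trapezoid a b s \<tau>"
  shows "v t x = 0"
proof -
  have "v t x \<le> 0"
    by (rule transport_max_principle[OF v \<tau> s eq speed _ mem]) (auto simp: init)
  moreover have "- vt t x + l t x * - vx t x = 0" if "(t, x) \<in> trapezoid a b s \<tau>" for t x
    using eq[OF that] by simp
  then have "- v t x \<le> 0"
    by (rule transport_max_principle[OF C1_partials_minus[OF v] \<tau> s _ speed _ mem]) (auto simp: init)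
  ultimately show ?thesis by simp
qed

section \<open>Convexity of powers and the Riccati inequality\<close>

lemma powr_above_tangent:
  fixes x y p :: real
  assumes "1 \<le> p" "0 < x" "0 < y"
  shows "p * y powr (p - 1) * (x - y) \<le> x powr p - y powr p"
proof -
  have "((\<lambda>z. z powr p) has_real_derivative p * y powr (p - 1)) (at y within {0<..})"
    using has_real_derivative_powr[OF assms(3)] by (rule has_field_derivative_at_within)
  then have "x powr p - y powr p \<ge> p * y powr (p - 1) * (x - y)"
    using assms by (intro convex_on_imp_above_tangent[OF powr_convex]) (auto simp: interior_open)
  then show ?thesis by simp
qed

text \<open>Division by \<open>y^2\<close> bounds the derivative of \<open>-1/y\<close> from below
  by \<open>k / (R + \<sigma> t)^3\<close>, which has an explicit antiderivative.\<close>

lemma riccati_blowup_bound: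
  fixes y y' :: "real \<Rightarrow> real"
  assumes pos: "0 < k" "0 < \<sigma>" "0 < R" "0 \<le> \<tau>" and y0: "0 < y 0"
    and deriv: "\<And>t. t \<in> {0..\<tau>} \<Longrightarrow> (y has_real_derivative y' t) (at t within {0..\<tau>})"
    and ineq: "\<And>t. t \<in> {0..\<tau>} \<Longrightarrow> k * (y t)\<^sup>2 / (R + \<sigma> * t) ^ 3 \<le> y' t"
  shows "k / (2 * \<sigma>) * (1 / R\<^sup>2 - 1 / (R + \<sigma> * \<tau>)\<^sup>2) < 1 / y 0"
proof -
  have base: "0 < R + \<sigma> * t" if "t \<in> {0..\<tau>}" for t
    using pos that by (auto intro: add_pos_nonneg)
  have mono: "f 0 \<le> f t" if t: "t \<in> {0..\<tau>}"
    and df: "\<And>t. t \<in> {0..\<tau>} \<Longrightarrow> (f has_real_derivative f' t) (at t within {0..\<tau>})"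
    and f': "\<And>t. t \<in> {0..\<tau>} \<Longrightarrow> 0 \<le> f' t" for f f' t
  proof -
    have "\<exists>z\<in>{0..t}. f t - f 0 = f' z * (t - 0)"
    proof (rule mvt_very_simple)
      show "0 \<le> t" using t by simp
      fix z assume "0 \<le> z" "z \<le> t"
      then show "(f has_derivative (*) (f' z)) (at z within {0..t})"
        using df[of z] t unfolding has_field_derivative_def
        by (auto intro: has_derivative_subset)
    qed
    then obtain z where z: "z \<in> {0..t}" "f t - f 0 = f' z * t" by auto
    moreover have "0 \<le> f' z * t" using f'[of z] z t by simp
    ultimately show ?thesis by linarith
  qed
  \<comment> \<open>The lower bound makes \<open>y\<close> nondecreasing, so it stays positive and
    can be divided by.\<close>
  have y_pos: "0 < y t" if "t \<in> {0..\<tau>}" for t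
  proof -
    have "0 \<le> y' z" if "z \<in> {0..\<tau>}" for z
      by (rule order_trans[OF _ ineq[OF that]]) (use pos base[OF that] in simp)
    from mono[OF that deriv this] y0 show ?thesis by simp
  qed
  \<comment> \<open>\<open>-1/y\<close> minus the antiderivative
    \<open>- k / (2 \<sigma> (R + \<sigma> t)^2)\<close>; the inequality says that \<open>f\<close>
    is nondecreasing.\<close>
  define f where "f t = - (1 / y t) + k / (2 * \<sigma>) * (1 / (R + \<sigma> * t)\<^sup>2)" for t
  have "f 0 \<le> f \<tau>"
  proof (rule mono)
    show "\<tau> \<in> {0..\<tau>}" using pos by simp
    fix t assume t: "t \<in> {0..\<tau>}"
    let ?b = "R + \<sigma> * t"
    show "(f has_real_derivative (y' t / (y t)\<^sup>2 - k / ?b ^ 3)) (at t within {0..\<tau>})"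
    proof -
      have "((\<lambda>t. 1 / y t) has_real_derivative - (y' t / (y t)\<^sup>2)) (at t within {0..\<tau>})"
        using y_pos[OF t] by (auto intro!: derivative_eq_intros deriv[OF t] simp: power2_eq_square)
      moreover have "((\<lambda>t. 1 / (R + \<sigma> * t)\<^sup>2) has_real_derivative - (2 * \<sigma> / ?b ^ 3)) (at t within {0..\<tau>})"
        using base[OF t] by (auto intro!: derivative_eq_intros simp: power2_eq_square power3_eq_cube)
      ultimately have "(f has_real_derivative - (- (y' t / (y t)\<^sup>2)) + k / (2 * \<sigma>) * (- (2 * \<sigma> / ?b ^ 3))) (at t within {0..\<tau>})"
        unfolding f_def by (intro DERIV_add DERIV_minus DERIV_cmult)
      then show ?thesis using pos by simp
    qed
    show "0 \<le> y' t / (y t)\<^sup>2 - k / ?b ^ 3"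
      using ineq[OF t] y_pos[OF t] base[OF t] by (simp add: field_simps)
  qed
  then have "k / (2 * \<sigma>) * (1 / R\<^sup>2 - 1 / (R + \<sigma> * \<tau>)\<^sup>2) \<le> 1 / y 0 - 1 / y \<tau>"
    by (simp add: f_def algebra_simps)
  also have "\<dots> < 1 / y 0"
    using y_pos[of \<tau>] pos by simp
  finally show ?thesis .
qed

section \<open>Sound speed and Riemann invariants\<close>

locale euler_flow =
  fixes K \<gamma> T \<rho>b R :: real and \<rho> u \<rho>t \<rho>x ut ux :: "real \<Rightarrow> real \<Rightarrow> real"
  assumes K_pos: "0 < K" and \<gamma>_ge2: "2 \<le> \<gamma>" and \<rho>b_pos: "0 < \<rho>b" and R_pos: "0 < R"
    and \<rho>_C1: "C1_partials ({0..<T} \<times> UNIV) \<rho> \<rho>t \<rho>x"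
    and u_C1: "C1_partials ({0..<T} \<times> UNIV) u ut ux"
    and \<rho>_pos: "\<lbrakk>0 \<le> t; t < T\<rbrakk> \<Longrightarrow> 0 < \<rho> t x"
    and mass: "\<lbrakk>0 \<le> t; t < T\<rbrakk> \<Longrightarrow> \<rho>t t x + (\<rho>x t x * u t x + \<rho> t x * ux t x) = 0"
    and momentum: "\<lbrakk>0 \<le> t; t < T\<rbrakk> \<Longrightarrow>
      \<rho> t x * (ut t x + u t x * ux t x) + K * \<gamma> * \<rho> t x powr (\<gamma> - 1) * \<rho>x t x = 0"
    and init: "R < \<bar>x\<bar> \<Longrightarrow> \<rho> 0 x = \<rho>b \<and> u 0 x = 0"
begin

text \<open>The speed \<open>sqrt (P'(r))\<close>, written as a multiple of a power so that the
  power rule differentiates it.\<close>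

definition sound :: "real \<Rightarrow> real" where
  "sound r = sqrt (K * \<gamma>) * r powr ((\<gamma> - 1) / 2)"

abbreviation \<sigma> :: real where "\<sigma> \<equiv> sound \<rho>b"

lemma \<gamma>_pos: "0 < \<gamma>"
  using \<gamma>_ge2 by simp

lemma sound_pos: "0 < r \<Longrightarrow> 0 < sound r"
  using K_pos \<gamma>_pos by (simp add: sound_def)

lemma sound_eq_sqrt:
  assumes "0 < r"
  shows "sound r = sqrt (K * \<gamma> * r powr (\<gamma> - 1))"
proof -
  have "r powr (\<gamma> - 1) = (r powr ((\<gamma> - 1) / 2))\<^sup>2"
    unfolding power2_eq_square powr_add[symmetric] by simp
  then show ?thesis
    by (simp add: sound_def real_sqrt_mult)
qed

lemma sound_inj:
  assumes "0 < r" "0 < r'" "sound r = sound r'"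
  shows "r = r'"
proof -
  have "r powr ((\<gamma> - 1) / 2) = r' powr ((\<gamma> - 1) / 2)"
    using assms K_pos \<gamma>_pos by (simp add: sound_def)
  moreover have "0 < (\<gamma> - 1) / 2" using \<gamma>_ge2 by simp
  ultimately show ?thesis
    using assms powr_less_mono2[of "(\<gamma> - 1) / 2"] by (metis less_imp_le less_irrefl linorder_neqE)
qed

text \<open>The sign \<open>e\<close>, 1 or -1, selects one of the two invariants, so that one
  argument covers both.\<close>

definition riemann_inv :: "real \<Rightarrow> real \<Rightarrow> real \<Rightarrow> real" where
  "riemann_inv e t x = u t x + e * (2 / (\<gamma> - 1)) * sound (\<rho> t x)"

text \<open>Chain rule with \<open>c' = (\<gamma> - 1) c / (2 \<rho>)\<close>, whose factor cancels
  against \<open>2 / (\<gamma> - 1)\<close>.\<close>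

definition riemann_dt :: "real \<Rightarrow> real \<Rightarrow> real \<Rightarrow> real" where
  "riemann_dt e t x = ut t x + e * (sound (\<rho> t x) / \<rho> t x) * \<rho>t t x"

definition riemann_dx :: "real \<Rightarrow> real \<Rightarrow> real \<Rightarrow> real" where
  "riemann_dx e t x = ux t x + e * (sound (\<rho> t x) / \<rho> t x) * \<rho>x t x"

lemma continuous_on_\<rho>: "continuous_on ({0..<T} \<times> UNIV) (\<lambda>p. \<rho> (fst p) (snd p))"
  using C1_partials_continuous_on[OF \<rho>_C1] by (simp add: split_beta)

lemma continuous_on_u: "continuous_on ({0..<T} \<times> UNIV) (\<lambda>p. u (fst p) (snd p))"
  using C1_partials_continuous_on[OF u_C1] by (simp add: split_beta)

lemma continuous_on_sound: "continuous_on ({0..<T} \<times> UNIV) (\<lambda>p. sound (\<rho> (fst p) (snd p)))"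
  unfolding sound_def
  using \<rho>_pos by (intro continuous_intros continuous_on_\<rho>) (auto simp: less_imp_neq[THEN not_sym])

lemma continuous_on_partials:
  assumes "f \<in> {\<rho>t, \<rho>x, ut, ux}"
  shows "continuous_on ({0..<T} \<times> UNIV) (\<lambda>p. f (fst p) (snd p))"
  using assms \<rho>_C1 u_C1 by (auto simp: C1_partials_def split_beta)

lemma sound_has_derivative:
  assumes "0 < r"
  shows "(sound has_real_derivative ((\<gamma> - 1) / 2 * (sound r / r))) (at r)"
proof -
  have "(sound has_real_derivative (sqrt (K * \<gamma>) * ((\<gamma> - 1) / 2 * r powr ((\<gamma> - 1) / 2 - 1)))) (at r)"
    unfolding sound_def using assms by (intro DERIV_cmult has_real_derivative_powr)
  then show ?thesis
    using assms by (simp add: sound_def powr_diff mult_ac)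
qed

lemma riemann_C1: "C1_partials ({0..<T} \<times> UNIV) (riemann_inv e) (riemann_dt e) (riemann_dx e)"
  unfolding C1_partials_def
proof (intro conjI allI impI)
  have ne: "\<rho> (fst p) (snd p) \<noteq> 0" if "p \<in> {0..<T} \<times> UNIV" for p
    using \<rho>_pos[of "fst p" "snd p"] that by auto
  show "continuous_on ({0..<T} \<times> UNIV) (\<lambda>(t, x). riemann_dt e t x)"
       "continuous_on ({0..<T} \<times> UNIV) (\<lambda>(t, x). riemann_dx e t x)"
    unfolding riemann_dt_def riemann_dx_def split_beta
    by (intro continuous_intros continuous_on_partials continuous_on_sound continuous_on_\<rho> ballI ne; simp)+
  fix t x assume tx: "(t, x) \<in> {0..<T} \<times> (UNIV :: real set)"
  let ?F = "at (t, x) within {0..<T} \<times> UNIV"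
  have pos: "0 < \<rho> t x" using tx \<rho>_pos by simp
  have d\<rho>: "((\<lambda>p. \<rho> (fst p) (snd p)) has_derivative (\<lambda>d. \<rho>t t x * fst d + \<rho>x t x * snd d)) ?F"
    and du: "((\<lambda>p. u (fst p) (snd p)) has_derivative (\<lambda>d. ut t x * fst d + ux t x * snd d)) ?F"
    using \<rho>_C1 u_C1 tx unfolding C1_partials_def split_beta by blast+
  have "((\<lambda>p. sound (\<rho> (fst p) (snd p))) has_derivative
      (\<lambda>d. (\<gamma> - 1) / 2 * (sound (\<rho> t x) / \<rho> t x) * (\<rho>t t x * fst d + \<rho>x t x * snd d))) ?F"
    using has_derivative_compose[OF d\<rho>,
        of sound "(*) ((\<gamma> - 1) / 2 * (sound (\<rho> t x) / \<rho> t x))"] sound_has_derivative[OF pos]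
    unfolding has_field_derivative_def by (simp only: fst_conv snd_conv)
  then have "((\<lambda>p. riemann_inv e (fst p) (snd p)) has_derivative
      (\<lambda>d. (ut t x * fst d + ux t x * snd d) + e * (2 / (\<gamma> - 1)) *
        ((\<gamma> - 1) / 2 * (sound (\<rho> t x) / \<rho> t x) * (\<rho>t t x * fst d + \<rho>x t x * snd d)))) ?F"
    unfolding riemann_inv_def by (intro has_derivative_add du has_derivative_mult_right)
  moreover have cancel: "e * (2 / (\<gamma> - 1)) * ((\<gamma> - 1) / 2 * q * d) = e * q * d" for q d
    using \<gamma>_ge2 by simp
  ultimately show "((\<lambda>(s, y). riemann_inv e s y) has_derivative
      (\<lambda>(ds, dy). riemann_dt e t x * ds + riemann_dx e t x * dy)) ?F"
    unfolding split_beta cancel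
    by (elim has_derivative_eq_rhs)
       (simp add: fun_eq_iff riemann_dt_def riemann_dx_def algebra_simps)
qed

text \<open>The momentum equation divided by \<open>\<rho>\<close>, since
  \<open>K \<gamma> \<rho>^(\<gamma> - 1)\<close> is the square of the sound speed.\<close>

lemma velocity_equation:
  assumes "0 \<le> t" "t < T"
  shows "ut t x + u t x * ux t x + (sound (\<rho> t x))\<^sup>2 / \<rho> t x * \<rho>x t x = 0"
proof -
  have pos: "0 < \<rho> t x" using \<rho>_pos assms by simp
  have "(sound (\<rho> t x))\<^sup>2 = K * \<gamma> * \<rho> t x powr (\<gamma> - 1)"
    using pos K_pos \<gamma>_pos by (simp add: sound_eq_sqrt)
  then have "\<rho> t x * (ut t x + u t x * ux t x + (sound (\<rho> t x))\<^sup>2 / \<rho> t x * \<rho>x t x) = 0"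
    using momentum[OF assms, of x] pos by (simp add: distrib_left)
  then show ?thesis using pos by simp
qed

text \<open>The left-hand side is the velocity equation plus \<open>e c / \<rho>\<close> times the
  mass equation; \<open>e^2 = 1\<close> gives the pressure term its coefficient.\<close>

lemma riemann_transport:
  assumes "0 \<le> t" "t < T" and e: "e\<^sup>2 = 1"
  shows "riemann_dt e t x + (u t x + e * sound (\<rho> t x)) * riemann_dx e t x = 0"
proof -
  have pos: "0 < \<rho> t x" using \<rho>_pos assms by simp
  define q where "q = sound (\<rho> t x) / \<rho> t x"
  have c: "sound (\<rho> t x) = q * \<rho> t x" using pos by (simp add: q_def)
  have vel: "ut t x + u t x * ux t x + q\<^sup>2 * \<rho> t x * \<rho>x t x = 0"
    using velocity_equation[OF assms(1,2), of x] pos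
    by (simp add: c power2_eq_square)
  have "riemann_dt e t x + (u t x + e * sound (\<rho> t x)) * riemann_dx e t x =
      (ut t x + u t x * ux t x + e\<^sup>2 * q\<^sup>2 * \<rho> t x * \<rho>x t x)
      + e * q * (\<rho>t t x + (\<rho>x t x * u t x + \<rho> t x * ux t x))"
    unfolding riemann_dt_def riemann_dx_def q_def[symmetric]
    by (simp add: c algebra_simps power2_eq_square)
  then show ?thesis
    using vel mass[OF assms(1,2), of x] e by simp
qed

section \<open>Finite propagation speed\<close>

text \<open>Half the sum of the two invariants is \<open>u\<close>, and their difference determines
  the sound speed, which is injective in the density.\<close>

lemma constant_state_if_riemann_const:
  assumes "0 \<le> t" "t < T"
    and "\<And>e. e\<^sup>2 = 1 \<Longrightarrow> riemann_inv e t x = e * (2 / (\<gamma> - 1)) * \<sigma>"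
  shows "\<rho> t x = \<rho>b \<and> u t x = 0"
proof -
  let ?k = "2 / (\<gamma> - 1)"
  have k: "0 < ?k" using \<gamma>_ge2 by simp
  have "u t x + ?k * sound (\<rho> t x) = ?k * \<sigma>" "u t x - ?k * sound (\<rho> t x) = - (?k * \<sigma>)"
    using assms(3)[of 1] assms(3)[of "-1"] by (simp_all add: riemann_inv_def)
  then have "u t x = 0" "?k * sound (\<rho> t x) = ?k * \<sigma>" by linarith+
  moreover from this(2) k have "sound (\<rho> t x) = \<sigma>" by (metis mult_left_cancel less_irrefl)
  ultimately show ?thesis
    using sound_inj \<rho>_pos[OF assms(1,2)] \<rho>b_pos by blast
qed

text \<open>The characteristic speeds are at most \<open>s\<close> before the first time at which \<open>\<bar>u\<bar> + c\<close> reaches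
  \<open>s > \<sigma>\<close> in the trapezoid; but up to that time the state is constant, so \<open>\<bar>u\<bar> + c = \<sigma>\<close> and the
  time cannot exist.\<close>
lemma constant_state_propagates:
  assumes s: "\<sigma> < s" and \<tau>: "\<tau> < T"
    and init_ab: "\<And>x. a \<le> x \<Longrightarrow> x \<le> b \<Longrightarrow> \<rho> 0 x = \<rho>b \<and> u 0 x = 0"
    and mem: "(t, x) \<in> trapezoid a b s \<tau>"
  shows "\<rho> t x = \<rho>b \<and> u t x = 0"
proof -
  have s0: "0 \<le> s" using s sound_pos[OF \<rho>b_pos] by simp
  define \<Lambda> where "\<Lambda> t x = \<bar>u t x\<bar> + sound (\<rho> t x)" for t x
  have const: "\<rho> t x = \<rho>b \<and> u t x = 0"
    if \<tau>': "\<tau>' \<le> \<tau>" and slow: "\<And>t x. (t, x) \<in> trapezoid a b s \<tau>' \<Longrightarrow> \<Lambda> t x \<le> s"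
      and mem: "(t, x) \<in> trapezoid a b s \<tau>'" for \<tau>' t x
  proof (rule constant_state_if_riemann_const)
    show t: "0 \<le> t" "t < T" using mem \<tau>' \<tau> by (auto simp: trapezoid_def)
    fix e :: real assume e: "e\<^sup>2 = 1"
    then have abs_e: "\<bar>e\<bar> = 1" by (auto simp: power2_eq_1_iff)
    let ?v = "\<lambda>t x. riemann_inv e t x - e * (2 / (\<gamma> - 1)) * \<sigma>"
    have C1: "C1_partials ({0..<T} \<times> UNIV) ?v (riemann_dt e) (riemann_dx e)"
      using riemann_C1[of e] unfolding C1_partials_def split_beta
      by (auto intro!: derivative_eq_intros)
    have "?v t x = 0"
    proof (rule transport_zero[OF C1 _ s0 _ _ _ mem])
      show "\<tau>' < T" using \<tau>' \<tau> by simp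
      show "\<And>x. a \<le> x \<Longrightarrow> x \<le> b \<Longrightarrow> ?v 0 x = 0"
        using init_ab by (simp add: riemann_inv_def)
      fix t x assume tx: "(t, x) \<in> trapezoid a b s \<tau>'"
      then have t: "0 \<le> t" "t < T" using \<tau>' \<tau> by (auto simp: trapezoid_def)
      then show "riemann_dt e t x + (u t x + e * sound (\<rho> t x)) * riemann_dx e t x = 0"
        using e by (rule riemann_transport)
      have "\<bar>u t x + e * sound (\<rho> t x)\<bar> \<le> \<bar>u t x\<bar> + \<bar>e * sound (\<rho> t x)\<bar>"
        by (rule abs_triangle_ineq)
      also have "\<dots> = \<Lambda> t x"
        using abs_e sound_pos[OF \<rho>_pos[OF t], of x] by (simp add: \<Lambda>_def abs_mult)
      finally show "\<bar>u t x + e * sound (\<rho> t x)\<bar> \<le> s"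
        using slow[OF tx] by simp
    qed
    then show "riemann_inv e t x = e * (2 / (\<gamma> - 1)) * \<sigma>" by simp
  qed
  let ?D = "trapezoid a b s \<tau>"
  have D_sub: "?D \<subseteq> {0..<T} \<times> UNIV" using \<tau> by (auto simp: trapezoid_def)
  have \<Lambda>_cont: "continuous_on ({0..<T} \<times> UNIV) (\<lambda>p. \<Lambda> (fst p) (snd p))"
    unfolding \<Lambda>_def by (intro continuous_intros continuous_on_u continuous_on_sound)
  \<comment> \<open>The set where the bound \<open>\<Lambda> < s\<close> fails. It is compact
    because the inequality \<open>s \<le> \<Lambda>\<close> is not strict, so if nonempty it has a
    point of least time.\<close>
  define B where "B = ?D \<inter> (\<lambda>p. \<Lambda> (fst p) (snd p)) -` {s..}"
  have "closed B"
    unfolding B_def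
    by (intro continuous_closed_preimage continuous_on_subset[OF \<Lambda>_cont D_sub]
        compact_imp_closed compact_trapezoid s0 closed_atLeast)
  moreover have "B = ?D \<inter> B" by (auto simp: B_def)
  ultimately have B_compact: "compact B"
    using compact_Int_closed[OF compact_trapezoid[OF s0]] by metis
  have "B = {}"
  proof (rule ccontr)
    assume "B \<noteq> {}"
    moreover have "continuous_on B fst" by (intro continuous_intros)
    ultimately obtain p where p: "p \<in> B" "\<And>q. q \<in> B \<Longrightarrow> fst p \<le> fst q"
      using continuous_attains_inf[OF B_compact] by blast
    define t0 x0 where "t0 = fst p" and "x0 = snd p"
    have mem0: "(t0, x0) \<in> ?D" and big: "s \<le> \<Lambda> t0 x0"
      using p(1) by (simp_all add: B_def t0_def x0_def)
    have t0: "0 \<le> t0" "t0 < T" "t0 \<le> \<tau>" using mem0 \<tau> by (auto simp: trapezoid_def)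
    \<comment> \<open>Before the least time the speeds are at most \<open>s\<close> in the whole
      trapezoid, and \<open>x0\<close> lies in it at earlier times because the sides move inwards,
      so \<open>const\<close> applies.\<close>
    have before: "\<Lambda> t x0 = \<sigma>" if t: "0 \<le> t" "t < t0" for t
    proof -
      have "\<rho> t x0 = \<rho>b \<and> u t x0 = 0"
      proof (rule const)
        show "t \<le> \<tau>" using t t0 by simp
        have "s * t \<le> s * t0" using t s0 by (simp add: mult_left_mono)
        then show "(t, x0) \<in> trapezoid a b s t"
          using mem0 t by (auto simp: trapezoid_def)
        fix t' x' assume "(t', x') \<in> trapezoid a b s t"
        then have D': "(t', x') \<in> ?D" "t' < t0"
          using t t0 by (auto simp: trapezoid_def)
        show "\<Lambda> t' x' \<le> s"
        proof (rule ccontr)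
          assume "\<not> \<Lambda> t' x' \<le> s"
          then have "(t', x') \<in> B" using D' by (simp add: B_def)
          with p(2)[of "(t', x')"] D' show False by (simp add: t0_def)
        qed
      qed
      then show ?thesis by (simp add: \<Lambda>_def)
    qed
    \<comment> \<open>The value on \<open>[0, t0)\<close> passes to \<open>t0\<close> by continuity;
      that interval is empty for \<open>t0 = 0\<close>, where the initial data are used.\<close>
    have "\<Lambda> t0 x0 = \<sigma>"
    proof (cases "t0 = 0")
      case True
      then show ?thesis using mem0 init_ab[of x0] by (simp add: trapezoid_def \<Lambda>_def)
    next
      case False
      have "closure {0..<t0} = {0..t0}" using False t0 by simp
      moreover have "continuous_on {0..t0} (\<lambda>t. \<Lambda> (fst (t, x0)) (snd (t, x0)))"
        by (rule continuous_on_compose2[OF \<Lambda>_cont]) (use t0 in \<open>auto intro!: continuous_intros\<close>)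
      ultimately show ?thesis
        using continuous_constant_on_closure[of "{0..<t0}" "\<lambda>t. \<Lambda> t x0" \<sigma> t0] before t0
        by simp
    qed
    with big s show False by simp
  qed
  then have "\<Lambda> t x \<le> s" if "(t, x) \<in> ?D" for t x
    using that by (force simp: B_def)
  then show ?thesis using const[OF order_refl _ mem] by blast
qed

text \<open>The trapezoid with base \<open>[x - s t, x + s t]\<close> shrinks to the point
  \<open>x\<close> at time \<open>t\<close>; for \<open>s\<close> slightly above
  \<open>\<sigma>\<close> its base misses \<open>[-R, R]\<close>.\<close>

lemma finite_propagation:
  assumes t: "0 \<le> t" "t < T" and x: "R + \<sigma> * t < \<bar>x\<bar>"
  shows "\<rho> t x = \<rho>b \<and> u t x = 0"
proof -
  \<comment> \<open>Makes \<open>\<delta> t\<close> smaller than the gap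
    \<open>|x| - R - \<sigma> t\<close>; the 1 added to \<open>t\<close> avoids division by zero at
    \<open>t = 0\<close>.\<close>
  define \<delta> where "\<delta> = (\<bar>x\<bar> - R - \<sigma> * t) / (2 * (t + 1))"
  have \<delta>: "0 < \<delta>" using t x by (simp add: \<delta>_def)
  define s where "s = \<sigma> + \<delta>"
  have s: "\<sigma> < s" "0 \<le> s * t" using \<delta> t sound_pos[OF \<rho>b_pos] by (simp_all add: s_def)
  have "\<delta> * (2 * (t + 1)) = \<bar>x\<bar> - R - \<sigma> * t" using t by (simp add: \<delta>_def)
  moreover have "0 \<le> \<delta> * t" using \<delta> t by simp
  ultimately have sx: "R + s * t < \<bar>x\<bar>" using \<delta> unfolding s_def distrib_left distrib_right by linarith
  show ?thesis
  proof (cases "0 \<le> x")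
    case True
    show ?thesis
      by (rule constant_state_propagates[OF s(1) t(2), of "x - s * t" "x + s * t"])
         (use True sx t s init in \<open>auto simp: trapezoid_def\<close>)
  next
    case False
    show ?thesis
      by (rule constant_state_propagates[OF s(1) t(2), of "x - s * t" "x + s * t"])
         (use False sx t s init in \<open>auto simp: trapezoid_def\<close>)
  qed
qed

end

section \<open>Integrals over bounded supports\<close>

lemma integral_UNIV_eq_integral_Icc:
  fixes f :: "real \<Rightarrow> real"
  assumes "\<And>x. a < \<bar>x\<bar> \<Longrightarrow> f x = 0"
  shows "integral UNIV f = integral {-a..a} f"
proof -
  have "f x = (if x \<in> {-a..a} then f x else 0)" for x
    using assms[of x] by (auto simp: not_le)
  then show ?thesis
    using integral_restrict_UNIV[of "{-a..a}" f] by presburger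
qed

text \<open>Integrate \<open>(f x - k x)\<^sup>2 \<ge> 0\<close> with the optimal \<open>k\<close>.\<close>
lemma first_moment_squared_le:
  fixes f :: "real \<Rightarrow> real"
  assumes s: "0 < s" and f: "continuous_on {-s..s} f"
  shows "3 / 2 * (integral {-s..s} (\<lambda>x. x * f x))\<^sup>2 / s ^ 3 \<le> integral {-s..s} (\<lambda>x. (f x)\<^sup>2)"
proof -
  let ?y = "integral {-s..s} (\<lambda>x. x * f x)"
  \<comment> \<open>The minimiser of \<open>\<integral> (f - k x)^2\<close>, namely
    \<open>?y\<close> divided by \<open>\<integral> x^2 = 2 s^3 / 3\<close>.\<close>
  define k where "k = 3 / 2 * ?y / s ^ 3"
  have "((\<lambda>x. x\<^sup>2) has_integral s ^ 3 / 3 - (- s) ^ 3 / 3) {-s..s}"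
    using s by (intro fundamental_theorem_of_calculus)
      (auto intro!: derivative_eq_intros simp: has_real_derivative_iff_has_vector_derivative[symmetric])
  then have sq: "((\<lambda>x. x\<^sup>2) has_integral 2 / 3 * s ^ 3) {-s..s}"
    by (simp add: power3_eq_cube mult.assoc)
  have "((\<lambda>x. (f x)\<^sup>2) has_integral integral {-s..s} (\<lambda>x. (f x)\<^sup>2)) {-s..s}"
       "((\<lambda>x. x * f x) has_integral ?y) {-s..s}"
    by (intro integrable_integral integrable_continuous_interval continuous_intros f)+
  then have "((\<lambda>x. (f x)\<^sup>2 - 2 * k * (x * f x) + k\<^sup>2 * x\<^sup>2) has_integral
      (integral {-s..s} (\<lambda>x. (f x)\<^sup>2) - 2 * k * ?y + k\<^sup>2 * (2 / 3 * s ^ 3))) {-s..s}"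
    by (intro has_integral_add has_integral_diff has_integral_mult_right sq)
  then have "0 \<le> integral {-s..s} (\<lambda>x. (f x)\<^sup>2) - 2 * k * ?y + k\<^sup>2 * (2 / 3 * s ^ 3)"
  proof (rule has_integral_nonneg)
    fix x
    have "(f x)\<^sup>2 - 2 * k * (x * f x) + k\<^sup>2 * x\<^sup>2 = (f x - k * x)\<^sup>2"
      by (simp add: power2_eq_square algebra_simps)
    then show "0 \<le> (f x)\<^sup>2 - 2 * k * (x * f x) + k\<^sup>2 * x\<^sup>2" by simp
  qed
  also have "- (2 * k * ?y) + k\<^sup>2 * (2 / 3 * s ^ 3) = - (3 / 2 * ?y\<^sup>2 / s ^ 3)"
    using s by (simp add: k_def field_simps power2_eq_square)
  then have "integral {-s..s} (\<lambda>x. (f x)\<^sup>2) - 2 * k * ?y + k\<^sup>2 * (2 / 3 * s ^ 3) =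
      integral {-s..s} (\<lambda>x. (f x)\<^sup>2) - 3 / 2 * ?y\<^sup>2 / s ^ 3"
    by linarith
  finally show ?thesis by simp
qed

section \<open>Conservation of mass and the Riccati inequality for the moment\<close>

context euler_flow
begin

lemma continuous_on_slice:
  assumes "continuous_on ({0..<T} \<times> UNIV) (\<lambda>p. f (fst p) (snd p))" "0 \<le> t" "t < T"
  shows "continuous_on A (f t)"
proof -
  have "continuous_on A (\<lambda>x. (t, x))" by (intro continuous_intros)
  from continuous_on_compose2[OF assms(1) this] assms(2,3) show ?thesis
    by (auto simp: image_subset_iff)
qed

lemma
  assumes "0 \<le> t" "t < T"
  shows \<rho>_dx: "(\<rho> t has_real_derivative \<rho>x t x) (at x within A)"
    and u_dx: "(u t has_real_derivative ux t x) (at x within A)"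
proof -
  have "((\<lambda>x. \<rho> t x) has_real_derivative (\<rho>t t x * 0 + \<rho>x t x * 1)) (at x within UNIV)"
    by (rule C1_partials_along_curve[OF \<rho>_C1]) (use assms in auto)
  then show "(\<rho> t has_real_derivative \<rho>x t x) (at x within A)"
    by (auto intro: has_field_derivative_at_within)
  have "((\<lambda>x. u t x) has_real_derivative (ut t x * 0 + ux t x * 1)) (at x within UNIV)"
    by (rule C1_partials_along_curve[OF u_C1]) (use assms in auto)
  then show "(u t has_real_derivative ux t x) (at x within A)"
    by (auto intro: has_field_derivative_at_within)
qed

lemma
  assumes "t \<in> {0..\<tau>}" "\<tau> < T"
  shows \<rho>_dt: "((\<lambda>t. \<rho> t x) has_real_derivative \<rho>t t x) (at t within {0..\<tau>})"
    and u_dt: "((\<lambda>t. u t x) has_real_derivative ut t x) (at t within {0..\<tau>})"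
proof -
  have "((\<lambda>t. \<rho> t x) has_real_derivative (\<rho>t t x * 1 + \<rho>x t x * 0)) (at t within {0..\<tau>})"
    by (rule C1_partials_along_curve[OF \<rho>_C1]) (use assms in auto)
  then show "((\<lambda>t. \<rho> t x) has_real_derivative \<rho>t t x) (at t within {0..\<tau>})" by simp
  have "((\<lambda>t. u t x) has_real_derivative (ut t x * 1 + ux t x * 0)) (at t within {0..\<tau>})"
    by (rule C1_partials_along_curve[OF u_C1]) (use assms in auto)
  then show "((\<lambda>t. u t x) has_real_derivative ut t x) (at t within {0..\<tau>})" by simp
qed

text \<open>The disturbed region grows with time, so one fixed interval serves for all times in
  \<open>{0..\<tau>}\<close> when integrals are differentiated.\<close>

lemma far_field:
  assumes "t \<in> {0..\<tau>}" "\<tau> < T" "R + \<sigma> * \<tau> < \<bar>x\<bar>"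
  shows "\<rho> t x = \<rho>b \<and> u t x = 0"
proof (rule finite_propagation)
  show "0 \<le> t" "t < T" using assms by auto
  have "\<sigma> * t \<le> \<sigma> * \<tau>" using assms sound_pos[OF \<rho>b_pos] by simp
  then show "R + \<sigma> * t < \<bar>x\<bar>" using assms by simp
qed

text \<open>Under the integral the time derivative is \<open>- (\<rho> u)_x\<close>, and the flux
  vanishes at \<open>-L\<close> and \<open>L\<close>.\<close>

lemma mass_conserved:
  assumes \<tau>: "0 \<le> \<tau>" "\<tau> < T" and L: "R + \<sigma> * \<tau> < L" and t: "t \<in> {0..\<tau>}"
  shows "integral {-L..L} (\<lambda>x. \<rho> t x - \<rho>b) = integral {-L..L} (\<lambda>x. \<rho> 0 x - \<rho>b)"
proof -
  have L0: "0 < L"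
    using L R_pos mult_nonneg_nonneg[OF less_imp_le[OF sound_pos[OF \<rho>b_pos]] \<tau>(1)] by linarith
  have "((\<lambda>t. integral (cbox (-L) L) (\<lambda>x. \<rho> t x - \<rho>b)) has_real_derivative 0) (at t within {0..\<tau>})"
    if t: "t \<in> {0..\<tau>}" for t
  proof -
    have t': "0 \<le> t" "t < T" using t \<tau> by auto
    have "((\<lambda>x. \<rho>x t x * u t x + ux t x * \<rho> t x) has_integral (\<rho> t L * u t L - \<rho> t (-L) * u t (-L))) {-L..L}"
      using L0
      by (intro fundamental_theorem_of_calculus)
         (auto simp: has_real_derivative_iff_has_vector_derivative[symmetric]
           intro!: DERIV_mult \<rho>_dx u_dx t')
    then have "((\<lambda>x. - (\<rho>x t x * u t x + ux t x * \<rho> t x)) has_integral - 0) {-L..L}"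
      using far_field[OF t \<tau>(2), of L] far_field[OF t \<tau>(2), of "-L"] L L0
      by (intro has_integral_neg) simp
    moreover have "- (\<rho>x t x * u t x + ux t x * \<rho> t x) = \<rho>t t x" for x
      using mass[OF t', of x] by (simp add: algebra_simps)
    ultimately have "integral {-L..L} (\<rho>t t) = 0"
      by (simp add: integral_unique)
    moreover have "((\<lambda>t. integral (cbox (-L) L) (\<lambda>x. \<rho> t x - \<rho>b)) has_real_derivative
        integral (cbox (-L) L) (\<rho>t t)) (at t within {0..\<tau>})"
    proof (rule leibniz_rule_field_derivative[OF _ _ _ t])
      show "((\<lambda>t. \<rho> t x - \<rho>b) has_real_derivative \<rho>t t x) (at t within {0..\<tau>})"
        if "t \<in> {0..\<tau>}" for t x
        using \<rho>_dt[OF that \<tau>(2), of x] by (auto intro!: derivative_eq_intros)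
      show "(\<lambda>x. \<rho> t x - \<rho>b) integrable_on cbox (- L) L" if "t \<in> {0..\<tau>}" for t
        by (intro integrable_continuous continuous_intros continuous_on_slice[OF continuous_on_\<rho>])
           (use that \<tau> in auto)
      show "continuous_on ({0..\<tau>} \<times> cbox (- L) L) (\<lambda>(t, x). \<rho>t t x)"
        unfolding split_beta
        by (rule continuous_on_subset[OF continuous_on_partials]) (use \<tau> in auto)
    qed simp
    ultimately show ?thesis by simp
  qed
  then have "\<exists>c. \<forall>t\<in>{0..\<tau>}. integral (cbox (-L) L) (\<lambda>x. \<rho> t x - \<rho>b) = c"
    by (intro has_field_derivative_zero_constant) auto
  moreover have "0 \<in> {0..\<tau>}" using \<tau> by simp
  ultimately show ?thesis using t by (metis cbox_interval)
qed

text \<open>The enthalpy \<open>h\<close> is written as \<open>c\<^sup>2/(\<gamma> - 1)\<close>.\<close>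
definition bernoulli :: "real \<Rightarrow> real \<Rightarrow> real" where
  "bernoulli t x = (u t x)\<^sup>2 / 2 + ((sound (\<rho> t x))\<^sup>2 - \<sigma>\<^sup>2) / (\<gamma> - 1)"

text \<open>The derivative is \<open>u u_x + c^2 \<rho>_x / \<rho>\<close>, so the velocity equation
  becomes a conservation law with this flux.\<close>

lemma bernoulli_dx:
  assumes t: "0 \<le> t" "t < T"
  shows "(bernoulli t has_real_derivative - ut t x) (at x within A)"
proof -
  have pos: "0 < \<rho> t x" using \<rho>_pos t by simp
  have "((\<lambda>x. sound (\<rho> t x)) has_real_derivative
      ((\<gamma> - 1) / 2 * (sound (\<rho> t x) / \<rho> t x) * \<rho>x t x)) (at x within A)"
    by (rule DERIV_chain2[OF sound_has_derivative[OF pos] \<rho>_dx[OF t]])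
  then have "(bernoulli t has_real_derivative
      (u t x * ux t x + (2 * sound (\<rho> t x) * ((\<gamma> - 1) / 2 * (sound (\<rho> t x) / \<rho> t x) * \<rho>x t x)) / (\<gamma> - 1)))
      (at x within A)"
    unfolding bernoulli_def by (auto intro!: derivative_eq_intros u_dx[OF t])
  moreover have "2 * sound (\<rho> t x) * ((\<gamma> - 1) / 2 * (sound (\<rho> t x) / \<rho> t x) * \<rho>x t x) / (\<gamma> - 1)
      = (sound (\<rho> t x))\<^sup>2 / \<rho> t x * \<rho>x t x"
    using \<gamma>_ge2 by (simp add: power2_eq_square)
  then have "u t x * ux t x + 2 * sound (\<rho> t x) * ((\<gamma> - 1) / 2 * (sound (\<rho> t x) / \<rho> t x) * \<rho>x t x) / (\<gamma> - 1)
      = - ut t x"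
    using velocity_equation[OF t, of x] by linarith
  ultimately show ?thesis by simp
qed

text \<open>Convexity of the enthalpy in the density is where \<open>\<gamma> \<ge> 2\<close> enters.\<close>
lemma bernoulli_ge:
  assumes "0 \<le> t" "t < T"
  shows "(u t x)\<^sup>2 / 2 + K * \<gamma> * \<rho>b powr (\<gamma> - 2) * (\<rho> t x - \<rho>b) \<le> bernoulli t x"
proof -
  have pos: "0 < \<rho> t x" using \<rho>_pos assms by simp
  have sq: "(sound r)\<^sup>2 = K * \<gamma> * r powr (\<gamma> - 1)" if "0 < r" for r
    using that K_pos \<gamma>_pos by (simp add: sound_eq_sqrt)
  \<comment> \<open>Multiplied by \<open>K \<gamma> / (\<gamma> - 1)\<close>, the tangent of the
    power at \<open>\<rho>b\<close> becomes that of the enthalpy, with slope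
    \<open>K \<gamma> \<rho>b^(\<gamma> - 2)\<close>.\<close>
  have "(\<gamma> - 1) * \<rho>b powr (\<gamma> - 2) * (\<rho> t x - \<rho>b) \<le> \<rho> t x powr (\<gamma> - 1) - \<rho>b powr (\<gamma> - 1)"
    using powr_above_tangent[OF _ pos \<rho>b_pos, of "\<gamma> - 1"] \<gamma>_ge2 by simp
  then have "K * \<gamma> * ((\<gamma> - 1) * \<rho>b powr (\<gamma> - 2) * (\<rho> t x - \<rho>b))
      \<le> K * \<gamma> * (\<rho> t x powr (\<gamma> - 1) - \<rho>b powr (\<gamma> - 1))"
    using K_pos \<gamma>_pos by (intro mult_left_mono) auto
  then have "(\<gamma> - 1) * (K * \<gamma> * \<rho>b powr (\<gamma> - 2) * (\<rho> t x - \<rho>b)) \<le> (sound (\<rho> t x))\<^sup>2 - \<sigma>\<^sup>2"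
    by (simp add: sq pos \<rho>b_pos algebra_simps)
  then have "K * \<gamma> * \<rho>b powr (\<gamma> - 2) * (\<rho> t x - \<rho>b) \<le> ((sound (\<rho> t x))\<^sup>2 - \<sigma>\<^sup>2) / (\<gamma> - 1)"
    using \<gamma>_ge2 by (simp add: pos_le_divide_eq mult.commute)
  then show ?thesis by (simp add: bernoulli_def)
qed

text \<open>Differentiation under the integral gives \<open>\<integral> x u_t\<close>; integrating
  \<open>(x B)_x = B - x u_t\<close>, with \<open>B\<close> zero at both endpoints, turns this into
  \<open>\<integral> B\<close>.\<close>

lemma moment_has_derivative:
  assumes \<tau>: "\<tau> < T" and L: "R + \<sigma> * \<tau> < L" "0 < L" and t: "t \<in> {0..\<tau>}"
  shows "((\<lambda>t. integral {-L..L} (\<lambda>x. x * u t x)) has_real_derivative integral {-L..L} (bernoulli t))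
           (at t within {0..\<tau>})"
proof -
  have t': "0 \<le> t" "t < T" using t \<tau> by auto
  have "((\<lambda>x. 1 * bernoulli t x + - ut t x * x) has_integral
      (L * bernoulli t L - (-L) * bernoulli t (-L))) {-L..L}"
    by (intro fundamental_theorem_of_calculus,
        use L in simp,
        unfold has_real_derivative_iff_has_vector_derivative[symmetric])
       (intro DERIV_mult DERIV_ident bernoulli_dx t')
  moreover have "bernoulli t L = 0" "bernoulli t (-L) = 0"
    using far_field[OF t \<tau>, of L] far_field[OF t \<tau>, of "-L"] L by (simp_all add: bernoulli_def)
  ultimately have zero: "integral {-L..L} (\<lambda>x. bernoulli t x - x * ut t x) = 0"
    by (simp add: integral_unique mult.commute)
  have bernoulli_cont: "continuous_on {-L..L} (bernoulli t)"
    using bernoulli_dx[OF t'] by (rule DERIV_continuous_on)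
  have "continuous_on {-L..L} (ut t)"
    using t' by (intro continuous_on_slice[OF continuous_on_partials]) auto
  then have "integral {-L..L} (\<lambda>x. x * ut t x) = integral {-L..L} (bernoulli t)"
    using zero bernoulli_cont
    by (subst (asm) integral_diff)
       (auto intro!: integrable_continuous_interval continuous_intros)
  moreover have "((\<lambda>t. integral (cbox (-L) L) (\<lambda>x. x * u t x)) has_real_derivative
      integral (cbox (-L) L) (\<lambda>x. x * ut t x)) (at t within {0..\<tau>})"
  proof (rule leibniz_rule_field_derivative[OF _ _ _ t])
    show "((\<lambda>t. x * u t x) has_real_derivative x * ut t x) (at t within {0..\<tau>})"
      if "t \<in> {0..\<tau>}" for t x
      using u_dt[OF that \<tau>, of x] by (rule DERIV_cmult)
    show "(\<lambda>x. x * u t x) integrable_on cbox (- L) L" if "t \<in> {0..\<tau>}" for t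
      by (intro integrable_continuous continuous_intros continuous_on_slice[OF continuous_on_u])
         (use that \<tau> in auto)
    have "continuous_on ({0..\<tau>} \<times> cbox (- L) L) (\<lambda>p. ut (fst p) (snd p))"
      by (rule continuous_on_subset[OF continuous_on_partials]) (use \<tau> in auto)
    then show "continuous_on ({0..\<tau>} \<times> cbox (- L) L) (\<lambda>(t, x). x * ut t x)"
      unfolding split_beta by (intro continuous_intros)
  qed simp
  ultimately show ?thesis by simp
qed

text \<open>In the integrated lower bound on \<open>bernoulli\<close> the term linear in
  \<open>\<rho> - \<rho>b\<close> is a multiple of the conserved nonnegative mass excess, and the
  kinetic term is bounded by the moment.\<close>

lemma moment_riccati:
  assumes \<tau>: "\<tau> < T" and L: "R + \<sigma> * \<tau> < L" and t: "t \<in> {0..\<tau>}"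
    and m: "0 \<le> integral {-L..L} (\<lambda>x. \<rho> 0 x - \<rho>b)"
  shows "3 / 4 * (integral {-L..L} (\<lambda>x. x * u t x))\<^sup>2 / (R + \<sigma> * t) ^ 3 \<le> integral {-L..L} (bernoulli t)"
proof -
  have t': "0 \<le> t" "t < T" using t \<tau> by auto
  let ?s = "R + \<sigma> * t"
  let ?c = "K * \<gamma> * \<rho>b powr (\<gamma> - 2)"
  have s: "0 < ?s" using R_pos t' sound_pos[OF \<rho>b_pos] by (simp add: add_pos_nonneg)
  have cont: "continuous_on A (u t)" "continuous_on A (\<rho> t)" for A
    using t' by (auto intro!: continuous_on_slice[OF continuous_on_u] continuous_on_slice[OF continuous_on_\<rho>])
  have vanish: "u t x = 0" if "?s < \<bar>x\<bar> \<or> L < \<bar>x\<bar>" for x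
    using that finite_propagation[OF t', of x] far_field[OF t \<tau>, of x] L by auto
  \<comment> \<open>Expressions vanishing with \<open>u\<close> may be integrated over
    \<open>[-?s, ?s]\<close> instead of the fixed interval, which gives the denominator
    \<open>(R + \<sigma> t)^3\<close> at time \<open>t\<close>.\<close>
  have restrict: "integral {-L..L} f = integral {-?s..?s} f"
    if "\<And>x. u t x = 0 \<Longrightarrow> f x = 0" for f :: "real \<Rightarrow> real"
    using that vanish by (metis integral_UNIV_eq_integral_Icc)
  have "3 / 2 * (integral {-L..L} (\<lambda>x. x * u t x))\<^sup>2 / ?s ^ 3 \<le> integral {-L..L} (\<lambda>x. (u t x)\<^sup>2)"
    using first_moment_squared_le[OF s cont(1)] by (simp add: restrict)
  moreover have "0 \<le> ?c * integral {-L..L} (\<lambda>x. \<rho> t x - \<rho>b)"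
    using m mass_conserved[OF _ \<tau> L t] K_pos \<gamma>_pos t by auto
  ultimately have "3 / 4 * (integral {-L..L} (\<lambda>x. x * u t x))\<^sup>2 / ?s ^ 3
      \<le> integral {-L..L} (\<lambda>x. (u t x)\<^sup>2) / 2 + ?c * integral {-L..L} (\<lambda>x. \<rho> t x - \<rho>b)"
    by simp
  also have "\<dots> = integral {-L..L} (\<lambda>x. (u t x)\<^sup>2 / 2 + ?c * (\<rho> t x - \<rho>b))"
    by (subst integral_add)
       (auto intro!: integrable_continuous_interval continuous_intros cont)
  also have "\<dots> \<le> integral {-L..L} (bernoulli t)"
    by (intro integral_le bernoulli_ge t' integrable_continuous_interval continuous_intros cont
        DERIV_continuous_on[OF bernoulli_dx]) auto
  finally show ?thesis .
qed

lemma lifespan_bound: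
  assumes \<tau>: "0 \<le> \<tau>" "\<tau> < T"
    and H: "0 < integral UNIV (\<lambda>x. x * u 0 x)"
    and m: "0 \<le> integral UNIV (\<lambda>x. \<rho> 0 x - \<rho>b)"
  shows "3 / (8 * \<sigma>) * (1 / R\<^sup>2 - 1 / (R + \<sigma> * \<tau>)\<^sup>2) < 1 / integral UNIV (\<lambda>x. x * u 0 x)"
proof -
  have \<sigma>: "0 < \<sigma>" using sound_pos \<rho>b_pos by blast
  \<comment> \<open>The added 1 puts the endpoints strictly outside the disturbed region, as
    \<open>far_field\<close> requires.\<close>
  define L where "L = R + \<sigma> * \<tau> + 1"
  have L: "R + \<sigma> * \<tau> < L" "R < L" "0 < L" using \<tau> \<sigma> R_pos by (auto simp: L_def intro: add_nonneg_pos)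
  have eqs: "integral UNIV (\<lambda>x. x * u 0 x) = integral {-L..L} (\<lambda>x. x * u 0 x)"
       "integral UNIV (\<lambda>x. \<rho> 0 x - \<rho>b) = integral {-L..L} (\<lambda>x. \<rho> 0 x - \<rho>b)"
    using init L by (auto intro!: integral_UNIV_eq_integral_Icc)
  have "3 / 4 / (2 * \<sigma>) * (1 / R\<^sup>2 - 1 / (R + \<sigma> * \<tau>)\<^sup>2) < 1 / integral {-L..L} (\<lambda>x. x * u 0 x)"
    by (rule riccati_blowup_bound[of "3 / 4" \<sigma> R \<tau> "\<lambda>t. integral {-L..L} (\<lambda>x. x * u t x)"
          "\<lambda>t. integral {-L..L} (bernoulli t)"])
       (use moment_has_derivative[OF \<tau>(2) L(1,3)] moment_riccati[OF \<tau>(2) L(1)] \<tau> \<sigma> R_pos H m eqs in auto)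
  then show ?thesis by (simp add: eqs)
qed

end

section \<open>Choice of a time that no solution can reach\<close>

text \<open>Solutions restrict to shorter intervals, so nonexistence for one \<open>T\<close> bounds
  every life span. Such a \<open>T\<close> is positive, because for \<open>T \<le> 0\<close> the
  solution predicate holds vacuously.\<close>

theorem theorem8:
  fixes K \<gamma> \<rho>bar R \<sigma> :: real and \<rho>0 u0 :: "real \<Rightarrow> real"
  assumes "K > 0" and "\<gamma> \<ge> 2" and "\<rho>bar > 0" and "R > 0"
    and "\<forall>x. \<bar>x\<bar> > R \<longrightarrow> \<rho>0 x = 0 \<and> u0 x = 0"
    and "\<sigma> = sqrt (K * \<gamma> * \<rho>bar powr (\<gamma> - 1))"
    and "integral UNIV (\<lambda>x. x * u0 x) > 8 * \<sigma> * R\<^sup>2 / 3"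
    and "integral UNIV (\<lambda>x. (\<rho>bar + \<rho>0 x) - \<rho>bar) \<ge> 0"
  shows "\<exists>T. \<not> (\<exists>\<rho> u. euler_C1_solution K \<gamma> T (\<lambda>x. \<rho>bar + \<rho>0 x) u0 \<rho> u)"
proof -
  define H where "H = integral UNIV (\<lambda>x. x * u0 x)"
  have \<sigma>: "0 < \<sigma>" using assms by simp
  have threshold: "0 < 8 * \<sigma> * R\<^sup>2 / 3" using \<sigma> assms(4) by simp
  then have H: "0 < H" "1 / H < 3 / (8 * \<sigma> * R\<^sup>2)"
    using assms(7) divide_strict_left_mono[of "8 * \<sigma> * R\<^sup>2 / 3" H 1] by (auto simp: H_def)
  \<comment> \<open>The amount by which the limit of the left-hand side of
    \<open>lifespan_bound\<close> for large times exceeds \<open>1 / H\<close>; the threshold on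
    \<open>H\<close> makes it positive.\<close>
  define \<delta> where "\<delta> = 3 / (8 * \<sigma> * R\<^sup>2) - 1 / H"
  have \<delta>: "0 < \<delta>" using H by (simp add: \<delta>_def)
  \<comment> \<open>Makes \<open>?b\<close> at least 1 and at least
    \<open>3 / (8 \<sigma> \<delta>)\<close>. Then \<open>?b^2\<close> is at least
    \<open>3 / (8 \<sigma> \<delta>)\<close> too, so the tail \<open>3 / (8 \<sigma> ?b^2)\<close>
    is at most \<open>\<delta>\<close>.\<close>
  define \<tau> where "\<tau> = (1 + 3 / (8 * \<sigma> * \<delta>)) / \<sigma>"
  have \<tau>: "0 \<le> \<tau>" using \<sigma> \<delta> by (simp add: \<tau>_def)
  let ?b = "R + \<sigma> * \<tau>"
  have b: "1 \<le> ?b" "3 / (8 * \<sigma> * \<delta>) \<le> ?b"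
    using \<sigma> \<delta> assms(4) by (simp_all add: \<tau>_def)
  have "?b * 1 \<le> ?b * ?b" using b by (intro mult_left_mono) auto
  then have "3 / (8 * \<sigma> * \<delta>) \<le> ?b\<^sup>2"
    using b unfolding power2_eq_square mult_1_right by linarith
  then have tail: "3 / (8 * \<sigma>) * (1 / ?b\<^sup>2) \<le> \<delta>"
    using \<sigma> \<delta> b by (simp add: field_simps)
  \<comment> \<open>The time interval of a solution is half-open, so the life span
    \<open>\<tau> + 1\<close> keeps \<open>\<tau>\<close> inside it.\<close>
  have "\<not> euler_C1_solution K \<gamma> (\<tau> + 1) (\<lambda>x. \<rho>bar + \<rho>0 x) u0 \<rho> u" for \<rho> u
  proof
    assume "euler_C1_solution K \<gamma> (\<tau> + 1) (\<lambda>x. \<rho>bar + \<rho>0 x) u0 \<rho> u"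
    then obtain \<rho>t \<rho>x ut ux where sol:
        "C1_partials ({0..<\<tau> + 1} \<times> UNIV) \<rho> \<rho>t \<rho>x"
        "C1_partials ({0..<\<tau> + 1} \<times> UNIV) u ut ux"
        "\<And>t x. \<lbrakk>0 \<le> t; t < \<tau> + 1\<rbrakk> \<Longrightarrow> \<rho> t x > 0"
        "\<And>t x. \<lbrakk>0 \<le> t; t < \<tau> + 1\<rbrakk> \<Longrightarrow> \<rho>t t x + (\<rho>x t x * u t x + \<rho> t x * ux t x) = 0"
        "\<And>t x. \<lbrakk>0 \<le> t; t < \<tau> + 1\<rbrakk> \<Longrightarrow>
          \<rho> t x * (ut t x + u t x * ux t x) + K * \<gamma> * \<rho> t x powr (\<gamma> - 1) * \<rho>x t x = 0"
      and data: "\<And>x. \<rho> 0 x = \<rho>bar + \<rho>0 x" "\<And>x. u 0 x = u0 x"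
      using \<tau> unfolding euler_C1_solution_def by auto
    interpret euler_flow K \<gamma> "\<tau> + 1" \<rho>bar R \<rho> u \<rho>t \<rho>x ut ux
      by unfold_locales (use assms sol data in auto)
    have "sound \<rho>bar = \<sigma>" using assms by (simp add: sound_eq_sqrt)
    then have "3 / (8 * \<sigma>) * (1 / R\<^sup>2 - 1 / ?b\<^sup>2) < 1 / H"
      using lifespan_bound[OF \<tau>] H assms(8) by (simp add: data H_def)
    with tail show False by (simp add: \<delta>_def right_diff_distrib)
  qed
  then show ?thesis by blast
qed

end
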